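(* Let $U$ be a universe of separations, let $S\subseteq U$ be a regular separation system (a subsystem of $U$), and let $\mathcal{P}$ be a set of closed profiles of $S$ such that $S$ is orderly with respect to $\mathcal{P}$. Then there is a tree set $T\subseteq S$ with the following properties: (1) Any two different elements of $\mathcal{P}$ are distinguished by some element of $T$. (2) Any element of $T$ distinguishes some two elements of $\mathcal{P}$. (3) For every $P\in\mathcal{P}$, every separation in $P\cap T$ lies below (is less than or equal to) some maximal element of $P\cap T$.
   Context: A separation system $(S,\leq,{}^* )$ is a partially ordered set with an order-reversing involution ${}^*$; its elements are called separations. A universe is a separation system $U$ in which any two elements $s,t$ have a supremum $s\vee t$ and an infimum $s\wedge t$. A subsystem of $U$ is a subset closed under ${}^*$ with the induced order and involution; suprema and infima of elements of $S$ are always taken in $U$ and need not lie in $S$. A separation system is regular if it contains no $s$ with $s\leq s^*$. An orientation of $S$ is a subset $O\subseteq S$ that contains, for every $s\in S$, exactly one element of the set $\{s,s^*\}$. It is consistent if there are no $r,s\in S$ with $r<s$, $r\neq s^*$, $r^*\in O$ and $s\in O$. A profile of $S$ is a consistent orientation $P$ of $S$ such that for all $s,t\in P$ the separation $(s\vee t)^*$ is not in $P$. A profile $P$ is closed if every nonempty chain in $P$ has a supremum in $U$ and this supremum is contained in $P$. $S$ is orderly with respect to $\mathcal{P}$ if for all $s,t\in S$ such that $\{s,t\}\subseteq P$ and $\{s^*,t^*\}\subseteq Q$ for some (possibly different) $P,Q\in\mathcal{P}$, we have $s\vee t\in S$ and $s\wedge t\in S$. A separation $s$ distinguishes profiles $P$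 and $Q$ if $s\neq s^*$ and one of $s,s^*$ lies in $P$ and the other one in $Q$. Two separations $s,t$ are nested if one of $s,s^*$ is comparable with one of $t,t^*$. A separation $s$ of a separation system is degenerate if $s=s^*$, and trivial if there is $r$ in that system with $s<r$ and $s<r^*$. A tree set is a separation system whose elements are pairwise nested and none of whose elements is trivial (in it) or degenerate. *)

theory Defs
  imports Main "HOL-Library.Lub_Glb"
begin

text \<open>
  The universe is the whole type, so that suprema and infima are always taken in it; separation
  systems are subsets of that type which are closed under the involution.
\<close>

class sep_universe = lattice +
  fixes star :: "'a \<Rightarrow> 'a"  (\<open>_\<^sup>\<star>\<close> [1000] 999)
  assumes star_star [simp]: "(s\<^sup>\<star>)\<^sup>\<star> = s"
    and star_antimono: "s \<le> t \<Longrightarrow> t\<^sup>\<star> \<le> s\<^sup>\<star>"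

definition separation_system :: "'a::sep_universe set \<Rightarrow> bool" where
  "separation_system S \<longleftrightarrow> (\<forall>s\<in>S. s\<^sup>\<star> \<in> S)"

definition regular :: "'a::sep_universe set \<Rightarrow> bool" where
  "regular S \<longleftrightarrow> \<not> (\<exists>s\<in>S. s \<le> s\<^sup>\<star>)"

text \<open>The unique existence ranges over elements of the set \<open>{s, s\<^sup>\<star>}\<close>, so an
  orientation contains every \<open>s\<close> with \<open>s = s\<^sup>\<star>\<close>.\<close>

definition orientation :: "'a::sep_universe set \<Rightarrow> 'a set \<Rightarrow> bool" where
  "orientation S O' \<longleftrightarrow> O' \<subseteq> S \<and> (\<forall>s\<in>S. \<exists>!x. x \<in> {s, s\<^sup>\<star>} \<and> x \<in> O')"

definition consistent :: "'a::sep_universe set \<Rightarrow> 'a set \<Rightarrow> bool" where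
  "consistent S O' \<longleftrightarrow>
     \<not> (\<exists>r\<in>S. \<exists>s\<in>S. r < s \<and> r \<noteq> s\<^sup>\<star> \<and> r\<^sup>\<star> \<in> O' \<and> s \<in> O')"

definition profile :: "'a::sep_universe set \<Rightarrow> 'a set \<Rightarrow> bool" where
  "profile S P \<longleftrightarrow> orientation S P \<and> consistent S P \<and> (\<forall>s\<in>P. \<forall>t\<in>P. (sup s t)\<^sup>\<star> \<notin> P)"

text \<open>The supremum of a chain is its least upper bound in the universe, i.e. in \<open>UNIV\<close>.\<close>

definition closed_profile :: "'a::sep_universe set \<Rightarrow> 'a set \<Rightarrow> bool" where
  "closed_profile S P \<longleftrightarrow> profile S P \<and>
     (\<forall>C. C \<subseteq> P \<and> C \<noteq> {} \<and> Complete_Partial_Order.chain (\<le>) C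
        \<longrightarrow> (\<exists>u. isLub UNIV C u \<and> u \<in> P))"

definition orderly :: "'a::sep_universe set \<Rightarrow> 'a set set \<Rightarrow> bool" where
  "orderly S \<P> \<longleftrightarrow>
     (\<forall>s\<in>S. \<forall>t\<in>S. (\<exists>P\<in>\<P>. {s, t} \<subseteq> P) \<and> (\<exists>Q\<in>\<P>. {s\<^sup>\<star>, t\<^sup>\<star>} \<subseteq> Q)
        \<longrightarrow> sup s t \<in> S \<and> inf s t \<in> S)"

definition distinguishes :: "'a::sep_universe \<Rightarrow> 'a set \<Rightarrow> 'a set \<Rightarrow> bool" where
  "distinguishes s P Q \<longleftrightarrow>
     s \<noteq> s\<^sup>\<star> \<and> (s \<in> P \<and> s\<^sup>\<star> \<in> Q \<or> s\<^sup>\<star> \<in> P \<and> s \<in> Q)"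

definition nested :: "'a::sep_universe \<Rightarrow> 'a \<Rightarrow> bool" where
  "nested s t \<longleftrightarrow> (\<exists>x\<in>{s, s\<^sup>\<star>}. \<exists>y\<in>{t, t\<^sup>\<star>}. x \<le> y \<or> y \<le> x)"

definition degenerate :: "'a::sep_universe \<Rightarrow> bool" where
  "degenerate s \<longleftrightarrow> s = s\<^sup>\<star>"

definition trivial_in :: "'a::sep_universe set \<Rightarrow> 'a \<Rightarrow> bool" where
  "trivial_in S s \<longleftrightarrow> (\<exists>r\<in>S. s < r \<and> s < r\<^sup>\<star>)"

definition tree_set :: "'a::sep_universe set \<Rightarrow> bool" where
  "tree_set T \<longleftrightarrow> separation_system T \<and> (\<forall>s\<in>T. \<forall>t\<in>T. nested s t) \<and>
     (\<forall>s\<in>T. \<not> trivial_in T s \<and> \<not> degenerate s)"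

definition maximal_element :: "'a::order set \<Rightarrow> 'a \<Rightarrow> bool" where
  "maximal_element A m \<longleftrightarrow> m \<in> A \<and> (\<forall>x\<in>A. \<not> m < x)"

end

theory Submission
  imports Defs
begin

text \<open>
  The tree set is a maximal set \<open>T\<close> of pairwise nested relevant separations, where a separation
  is relevant if it distinguishes two members of \<open>\<P>\<close>. Such a set exists by Zorn's lemma, and
  regularity excludes trivial and degenerate elements. So only the first and the third property
  need an argument, and in both cases a suitable relevant separation is shown to be nested with
  all of \<open>T\<close>, so that it lies in \<open>T\<close> by maximality.

  For the third property this separation is the supremum of a chain in \<open>P \<inter> T\<close>: it exists because
  \<open>P\<close> is closed, and nestedness survives suprema of chains (\<open>nested_chain_Lub\<close>). Hence \<open>P \<inter> T\<close> is
  closed under suprema of chains, and Zorn's lemma yields the maximal elements.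

  For the first property, suppose that \<open>T\<close> does not distinguish \<open>P\<close> from \<open>Q\<close>. The separations that
  do, oriented so as to lie in \<open>P\<close>, form a set \<open>separators P Q\<close> which is a lattice, as \<open>S\<close> is
  orderly, and in which chains have suprema and infima, as \<open>P\<close> and \<open>Q\<close> are closed; so it is a
  complete lattice (\<open>separators_Lub\<close>, \<open>separators_Glb\<close>). Its greatest element \<open>s\<close> may cross
  elements of \<open>T\<close>. However, if \<open>t \<in> P \<inter> T\<close> is not below \<open>s\<close>, then any \<open>R \<in> \<P>\<close> containing
  \<open>t\<^sup>\<star>\<close> also contains \<open>s\<close>, since otherwise \<open>s \<squnion> t\<close> would be a larger separator. With \<open>R\<close> and \<open>Q\<close>
  as witnesses, orderliness now gives that the corner \<open>s \<sqinter> t\<^sup>\<star>\<close> lies in \<open>S\<close>, and it still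
  separates \<open>P\<close> from \<open>Q\<close>. The infimum of all these corners separates \<open>P\<close> from \<open>Q\<close> and is nested
  with \<open>T\<close> (\<open>nested_separator_exists\<close>).
\<close>

section \<open>The involution and nestedness\<close>

lemma star_le_iff [simp]: "s\<^sup>\<star> \<le> t\<^sup>\<star> \<longleftrightarrow> t \<le> (s::'a::sep_universe)"
  by (metis star_antimono star_star)

lemma le_star_iff: "s \<le> t\<^sup>\<star> \<longleftrightarrow> t \<le> (s::'a::sep_universe)\<^sup>\<star>"
  by (metis star_antimono star_star)

lemma star_sup: "(sup s t)\<^sup>\<star> = inf (s\<^sup>\<star>) ((t::'a::sep_universe)\<^sup>\<star>)"
proof (rule order.antisym)
  show "(sup s t)\<^sup>\<star> \<le> inf (s\<^sup>\<star>) (t\<^sup>\<star>)"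
    by simp
  have "sup s t \<le> (inf (s\<^sup>\<star>) (t\<^sup>\<star>))\<^sup>\<star>"
    by (metis inf_le1 inf_le2 le_star_iff sup_least)
  then show "inf (s\<^sup>\<star>) (t\<^sup>\<star>) \<le> (sup s t)\<^sup>\<star>"
    by (simp add: le_star_iff)
qed

lemma star_inf: "(inf s t)\<^sup>\<star> = sup (s\<^sup>\<star>) ((t::'a::sep_universe)\<^sup>\<star>)"
  by (metis star_sup star_star)

lemma nested_iff:
  "nested s t \<longleftrightarrow> s \<le> t \<or> t \<le> s \<or> s \<le> t\<^sup>\<star> \<or> t\<^sup>\<star> \<le> (s::'a::sep_universe)"
  unfolding nested_def by (auto simp: le_star_iff) (metis star_le_iff star_star)+

lemma nested_sym: "nested s t \<longleftrightarrow> nested t s"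
  unfolding nested_def by blast

lemma nested_refl: "nested s s"
  by (simp add: nested_iff)

lemma nested_star: "nested (s\<^sup>\<star>) t \<longleftrightarrow> nested s t"
  unfolding nested_def by (simp add: disj_commute)

text \<open>
  Either some element of the chain lies above \<open>t\<close> or \<open>t\<^sup>\<star>\<close>, and then so does the supremum; or each
  lies below \<open>t\<close> or \<open>t\<^sup>\<star>\<close>, and then all of them lie below the same one of these two, because an
  element \<open>c\<close> not below \<open>t\<close> and an element \<open>d\<close> not below \<open>t\<^sup>\<star>\<close> could not be comparable.
\<close>

lemma nested_chain_Lub:
  fixes t :: "'a::sep_universe"
  assumes chain: "Complete_Partial_Order.chain (\<le>) C" and lub: "isLub UNIV C u"
    and nested: "\<And>c. c \<in> C \<Longrightarrow> nested c t"
  shows "nested u t"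
proof (cases "\<exists>c\<in>C. t \<le> c \<or> t\<^sup>\<star> \<le> c")
  case True
  moreover have "c \<le> u" if "c \<in> C" for c
    using lub that by (meson isLubD2)
  ultimately show ?thesis
    unfolding nested_iff by (meson order.trans)
next
  case False
  then have below: "c \<le> t \<or> c \<le> t\<^sup>\<star>" if "c \<in> C" for c
    using nested that unfolding nested_iff by blast
  have "(\<forall>c\<in>C. c \<le> t) \<or> (\<forall>c\<in>C. c \<le> t\<^sup>\<star>)"
  proof (rule ccontr)
    assume "\<not> ?thesis"
    then obtain c d where cd: "c \<in> C" "\<not> c \<le> t" "d \<in> C" "\<not> d \<le> t\<^sup>\<star>"
      by blast
    then have "c \<le> d \<or> d \<le> c"
      using chain by (simp add: chain_def)
    with cd below show False
      by (meson order.trans)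
  qed
  then have "u \<le> t \<or> u \<le> t\<^sup>\<star>"
    using lub by (meson UNIV_I isLub_le_isUb isUbI setleI)
  then show ?thesis
    unfolding nested_iff by blast
qed

text \<open>
  Zorn's lemma for the partial order of the type, restricted to a nonempty set; the empty chain
  has its upper bound in \<open>A\<close> because \<open>A\<close> is nonempty.
\<close>

lemma Zorn_order:
  fixes A :: "'a::order set"
  assumes "A \<noteq> {}"
    and bound: "\<And>C. C \<subseteq> A \<Longrightarrow> C \<noteq> {} \<Longrightarrow> Complete_Partial_Order.chain (\<le>) C
      \<Longrightarrow> \<exists>u\<in>A. \<forall>c\<in>C. c \<le> u"
  obtains m where "maximal_element A m"
proof -
  have "\<exists>m\<in>A. \<forall>a\<in>A. m \<le> a \<longrightarrow> a = m"
  proof (rule predicate_Zorn)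
    show "partial_order_on A (relation_of (\<le>) A)"
      by (rule partial_order_on_relation_ofI) auto
  next
    fix C assume "C \<in> Chains (relation_of (\<le>) A)"
    then have "C \<subseteq> A" "Complete_Partial_Order.chain (\<le>) C"
      by (auto simp: Chains_def relation_of_def chain_def)
    then show "\<exists>u\<in>A. \<forall>a\<in>C. a \<le> u"
      using bound[of C] \<open>A \<noteq> {}\<close> by (cases "C = {}") auto
  qed
  then show thesis
    using that unfolding maximal_element_def by (metis less_le)
qed

section \<open>The complete lattice of separations between two closed profiles\<close>

definition separators :: "'a::sep_universe set \<Rightarrow> 'a set \<Rightarrow> 'a set" where
  "separators P Q = {s \<in> P. s\<^sup>\<star> \<in> Q}"

lemma star_mem_separators_iff [simp]: "s\<^sup>\<star> \<in> separators P Q \<longleftrightarrow> s \<in> separators Q P"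
  by (auto simp: separators_def)

locale orderly_closed_profiles =
  fixes S :: "'u::sep_universe set" and \<P> :: "'u set set"
  assumes system: "separation_system S"
    and regular: "regular S"
    and closed: "\<And>P. P \<in> \<P> \<Longrightarrow> closed_profile S P"
    and orderly: "orderly S \<P>"
begin

lemma star_mem [simp]: "s\<^sup>\<star> \<in> S \<longleftrightarrow> s \<in> S"
  using system unfolding separation_system_def by (metis star_star)

lemma not_le_star: "s \<in> S \<Longrightarrow> \<not> s \<le> s\<^sup>\<star>"
  using regular unfolding regular_def by blast

lemma star_neq: "s \<in> S \<Longrightarrow> s \<noteq> s\<^sup>\<star>"
  using not_le_star by fastforce

lemma profileD: "P \<in> \<P> \<Longrightarrow> profile S P"
  using closed unfolding closed_profile_def by blast

lemma profile_subset: "P \<in> \<P> \<Longrightarrow> P \<subseteq> S"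
  using profileD unfolding profile_def orientation_def by blast

lemma star_mem_profile_iff: "P \<in> \<P> \<Longrightarrow> s \<in> S \<Longrightarrow> s\<^sup>\<star> \<in> P \<longleftrightarrow> s \<notin> P"
  using profileD[of P] star_neq[of s] unfolding profile_def orientation_def by auto

text \<open>
  The exceptional case \<open>r = s\<^sup>\<star>\<close> in the definition of consistency would make
  \<open>s\<^sup>\<star>\<close> lie below its inverse, which regularity excludes.
\<close>

lemma profile_down_closed:
  assumes "P \<in> \<P>" "s \<in> P" "r \<in> S" "r \<le> s"
  shows "r \<in> P"
proof (rule ccontr)
  assume "r \<notin> P"
  then have "r\<^sup>\<star> \<in> P" "r < s"
    using assms star_mem_profile_iff by (auto simp: less_le)
  moreover have "r \<noteq> s\<^sup>\<star>"
    using not_le_star[OF \<open>r \<in> S\<close>] \<open>r \<le> s\<close> by auto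
  ultimately show False
    using profileD[OF \<open>P \<in> \<P>\<close>] assms profile_subset[OF \<open>P \<in> \<P>\<close>]
    unfolding profile_def consistent_def by blast
qed

lemma profile_sup_closed:
  assumes "P \<in> \<P>" "s \<in> P" "t \<in> P" "sup s t \<in> S"
  shows "sup s t \<in> P"
  using assms profileD star_mem_profile_iff unfolding profile_def by blast

lemma profile_chain_Lub:
  assumes "P \<in> \<P>" "C \<subseteq> P" "C \<noteq> {}" "Complete_Partial_Order.chain (\<le>) C"
  obtains u where "isLub UNIV C u" "u \<in> P"
  using closed[OF \<open>P \<in> \<P>\<close>] assms unfolding closed_profile_def by blast

lemma orderlyD:
  assumes "P \<in> \<P>" "Q \<in> \<P>" "s \<in> separators P Q" "t \<in> separators P Q"
  shows "sup s t \<in> S" "inf s t \<in> S"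
proof -
  have "s \<in> S" "t \<in> S" "{s, t} \<subseteq> P" "{s\<^sup>\<star>, t\<^sup>\<star>} \<subseteq> Q"
    using assms profile_subset unfolding separators_def by auto
  then show "sup s t \<in> S" "inf s t \<in> S"
    using orderly assms(1,2) unfolding orderly_def by blast+
qed

lemma separators_subset: "P \<in> \<P> \<Longrightarrow> separators P Q \<subseteq> S"
  using profile_subset unfolding separators_def by blast

lemma separators_up_closed:
  assumes "P \<in> \<P>" "Q \<in> \<P>" "s \<in> separators P Q" "u \<in> P" "s \<le> u"
  shows "u \<in> separators P Q"
  using assms profile_subset profile_down_closed[of Q "s\<^sup>\<star>" "u\<^sup>\<star>"] star_mem
  unfolding separators_def by auto

lemma separators_down_closed:
  assumes "P \<in> \<P>" "Q \<in> \<P>" "s \<in> separators P Q" "u\<^sup>\<star> \<in> Q" "u \<le> s"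
  shows "u \<in> separators P Q"
  using separators_up_closed[of Q P "s\<^sup>\<star>" "u\<^sup>\<star>"] assms by simp

lemma separators_sup:
  assumes "P \<in> \<P>" "Q \<in> \<P>" "s \<in> separators P Q" "t \<in> separators P Q"
  shows "sup s t \<in> separators P Q"
  using assms orderlyD profile_sup_closed separators_up_closed[of P Q s "sup s t"]
  unfolding separators_def by auto

text \<open>
  The separators below all upper bounds of \<open>B\<close> are closed under binary suprema and suprema of
  chains. So Zorn's lemma gives a maximal one among them, which is even greatest: it is then an
  upper bound of \<open>B\<close> itself.
\<close>

lemma separators_Lub:
  assumes PQ: "P \<in> \<P>" "Q \<in> \<P>" and B: "B \<subseteq> separators P Q" "B \<noteq> {}"
  obtains u where "u \<in> separators P Q" "isLub UNIV B u"
proof -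
  define X where "X = {x \<in> separators P Q. \<forall>v. (\<forall>b\<in>B. b \<le> v) \<longrightarrow> x \<le> v}"
  have BX: "B \<subseteq> X"
    using B unfolding X_def by blast
  obtain m where m: "maximal_element X m"
  proof (rule Zorn_order)
    show "X \<noteq> {}"
      using BX B by blast
  next
    fix C assume C: "C \<subseteq> X" "C \<noteq> {}" "Complete_Partial_Order.chain (\<le>) C"
    then have "C \<subseteq> P"
      unfolding X_def separators_def by blast
    then obtain u where u: "isLub UNIV C u" "u \<in> P"
      using profile_chain_Lub PQ C by metis
    have upper: "c \<le> u" if "c \<in> C" for c
      using u that by (meson isLubD2)
    have "u \<in> separators P Q"
      using C u upper PQ separators_up_closed unfolding X_def by blast
    moreover have "u \<le> v" if "\<forall>b\<in>B. b \<le> v" for v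
    proof (rule isLub_le_isUb[OF u(1)])
      show "isUb UNIV C v"
        using C that unfolding X_def by (intro isUbI setleI) auto
    qed
    ultimately show "\<exists>u\<in>X. \<forall>c\<in>C. c \<le> u"
      using upper unfolding X_def by blast
  qed
  have "x \<le> m" if "x \<in> X" for x
  proof -
    have "sup x m \<in> X"
      using that m separators_sup PQ unfolding X_def maximal_element_def by auto
    then have "\<not> m < sup x m"
      using m unfolding maximal_element_def by blast
    then show ?thesis
      by (metis less_le sup.cobounded2 sup.cobounded1)
  qed
  moreover have "m \<in> X"
    using m unfolding maximal_element_def by blast
  ultimately have "isLub UNIV B m"
    using BX unfolding X_def isLub_def leastP_def setle_def setge_def isUb_def by auto
  with \<open>m \<in> X\<close> show thesis
    using that unfolding X_def by blast
qed

text \<open>The involution turns infima of separators of \<open>P\<close> and \<open>Q\<close> into suprema of separators of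
  \<open>Q\<close> and \<open>P\<close>.\<close>

lemma separators_Glb:
  assumes PQ: "P \<in> \<P>" "Q \<in> \<P>" and B: "B \<subseteq> separators P Q" "B \<noteq> {}"
  obtains l where "l \<in> separators P Q" "\<forall>b\<in>B. l \<le> b"
    "\<And>v. \<forall>b\<in>B. v \<le> b \<Longrightarrow> v \<le> l"
proof -
  have "star ` B \<subseteq> separators Q P" "star ` B \<noteq> {}"
    using B by auto
  then obtain u where u: "u \<in> separators Q P" "isLub UNIV (star ` B) u"
    using separators_Lub PQ by blast
  show thesis
  proof (rule that[of "u\<^sup>\<star>"])
    show "u\<^sup>\<star> \<in> separators P Q"
      using u by simp
    have "u\<^sup>\<star> \<le> b" if "b \<in> B" for b
      using isLubD2[OF u(2)] that star_le_iff[of u "b\<^sup>\<star>"] by simp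
    then show "\<forall>b\<in>B. u\<^sup>\<star> \<le> b"
      by blast
    show "v \<le> u\<^sup>\<star>" if "\<forall>b\<in>B. v \<le> b" for v
    proof -
      have "u \<le> v\<^sup>\<star>"
        using that by (intro isLub_le_isUb[OF u(2)] isUbI setleI) auto
      then show ?thesis
        by (simp add: le_star_iff)
    qed
  qed
qed

lemma separators_nonempty:
  assumes "P \<in> \<P>" "Q \<in> \<P>" "P \<noteq> Q"
  shows "separators P Q \<noteq> {}"
proof -
  consider s where "s \<in> P" "s \<notin> Q" | s where "s \<in> Q" "s \<notin> P"
    using \<open>P \<noteq> Q\<close> by blast
  then show ?thesis
  proof cases
    case 1
    then have "s \<in> separators P Q"
      using assms star_mem_profile_iff profile_subset unfolding separators_def by auto
    then show ?thesis by blast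
  next
    case 2
    then have "s\<^sup>\<star> \<in> separators P Q"
      using assms star_mem_profile_iff profile_subset unfolding separators_def by auto
    then show ?thesis by blast
  qed
qed

lemma distinguishes_iff:
  assumes "P \<in> \<P>"
  shows "distinguishes s P Q \<longleftrightarrow> s \<in> separators P Q \<or> s\<^sup>\<star> \<in> separators P Q"
proof -
  have "s \<noteq> s\<^sup>\<star>" if "s \<in> P \<or> s\<^sup>\<star> \<in> P"
    using that assms profile_subset star_neq star_mem by blast
  then show ?thesis
    unfolding distinguishes_def separators_def by auto
qed

section \<open>Maximal nested sets of relevant separations\<close>

definition relevant :: "'u set" where
  "relevant = (\<Union>P\<in>\<P>. \<Union>Q\<in>\<P>. separators P Q)"

lemma relevantI: "P \<in> \<P> \<Longrightarrow> Q \<in> \<P> \<Longrightarrow> s \<in> separators P Q \<Longrightarrow> s \<in> relevant"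
  unfolding relevant_def by blast

lemma relevant_subset: "relevant \<subseteq> S"
  using separators_subset unfolding relevant_def by blast

lemma relevant_star: "s \<in> relevant \<Longrightarrow> s\<^sup>\<star> \<in> relevant"
  unfolding relevant_def by auto

lemma relevant_in_separators:
  assumes "P \<in> \<P>" "s \<in> relevant" "s \<in> P"
  obtains R where "R \<in> \<P>" "s \<in> separators P R"
  using assms unfolding relevant_def separators_def by blast

text \<open>
  The candidate is the infimum \<open>b\<close> of \<open>s\<close> and the corners \<open>s \<sqinter> r\<^sup>\<star>\<close>, where \<open>s\<close> is the
  greatest separator of \<open>P\<close> and \<open>Q\<close> and \<open>r\<close> ranges over the elements of \<open>P \<inter> T\<close> not below \<open>s\<close>.
  Each of these \<open>r\<close> satisfies \<open>b \<le> r\<^sup>\<star>\<close>. An element \<open>t\<close> of \<open>P \<inter> T\<close> below \<open>s\<close> either lies below some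
  such \<open>r\<close>, whence \<open>b \<le> t\<^sup>\<star>\<close>, or lies below \<open>r\<^sup>\<star>\<close> for all of them, whence \<open>t \<le> b\<close>.
\<close>

lemma nested_separator_exists:
  assumes PQ: "P \<in> \<P>" "Q \<in> \<P>" "P \<noteq> Q"
    and T: "T \<subseteq> relevant" "\<And>s t. s \<in> T \<Longrightarrow> t \<in> T \<Longrightarrow> nested s t"
      "\<And>t. t \<in> T \<Longrightarrow> t\<^sup>\<star> \<in> T"
    and undistinguished: "T \<inter> separators P Q = {}"
  obtains b where "b \<in> separators P Q" "\<And>t. t \<in> T \<Longrightarrow> nested b t"
proof -
  obtain s where s: "s \<in> separators P Q" "isLub UNIV (separators P Q) s"
    using separators_Lub[OF PQ(1,2) order.refl] separators_nonempty[OF PQ] by blast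
  have greatest: "x \<le> s" if "x \<in> separators P Q" for x
    using isLubD2[OF s(2)] that by blast
  have sPQ: "s \<in> P" "s\<^sup>\<star> \<in> Q" "s \<in> S"
    using s PQ profile_subset unfolding separators_def by auto
  have TS: "t \<in> S" if "t \<in> T" for t
    using that T relevant_subset by blast
  have in_Q: "t \<in> Q" if "t \<in> P \<inter> T" for t
    using that undistinguished TS star_mem_profile_iff PQ unfolding separators_def by auto
  define I where "I = {t \<in> P \<inter> T. \<not> t \<le> s}"
  have corner: "inf s (t\<^sup>\<star>) \<in> separators P Q" if "t \<in> I" for t
  proof -
    have t: "t \<in> P" "t \<in> T" "t \<in> S" "\<not> t \<le> s" "t \<in> Q"
      using that TS in_Q unfolding I_def by auto
    obtain R where R: "R \<in> \<P>" "t \<in> separators P R"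
      using relevant_in_separators PQ T t by blast
    have "s \<in> R"
    proof (rule ccontr)
      assume "s \<notin> R"
      then have "s \<in> separators P R"
        using sPQ R star_mem_profile_iff unfolding separators_def by auto
      then have "sup s t \<in> P"
        using separators_sup PQ R unfolding separators_def by blast
      then have "sup s t \<in> separators P Q"
        using separators_up_closed PQ s by (metis sup_ge1)
      then show False
        using greatest t by (meson le_sup_iff)
    qed
    \<comment> \<open>So \<open>s\<close> and \<open>t\<^sup>\<star>\<close> both point from \<open>R\<close> to \<open>Q\<close>, which brings their infimum into \<open>S\<close>.\<close>
    then have "s \<in> separators R Q" "t\<^sup>\<star> \<in> separators R Q"
      using R sPQ t unfolding separators_def by auto
    then have inS: "inf s (t\<^sup>\<star>) \<in> S"
      using orderlyD PQ R by blast
    then have "sup (s\<^sup>\<star>) t \<in> Q"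
      using profile_sup_closed[of Q "s\<^sup>\<star>" t] PQ sPQ t star_mem[of "inf s (t\<^sup>\<star>)"]
      by (simp add: star_inf)
    then show ?thesis
      using separators_down_closed[OF PQ(1,2) s(1), of "inf s (t\<^sup>\<star>)"] by (simp add: star_inf)
  qed
  define B where "B = insert s ((\<lambda>t. inf s (t\<^sup>\<star>)) ` I)"
  have "B \<subseteq> separators P Q"
    using s corner unfolding B_def by blast
  moreover have "B \<noteq> {}"
    unfolding B_def by blast
  ultimately obtain b where b: "b \<in> separators P Q" "\<forall>x\<in>B. b \<le> x"
    "\<And>v. \<forall>x\<in>B. v \<le> x \<Longrightarrow> v \<le> b"
    using separators_Glb[OF PQ(1,2)] by metis
  have b_le: "b \<le> r\<^sup>\<star>" if "r \<in> I" for r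
  proof -
    have "b \<le> inf s (r\<^sup>\<star>)"
      using that b unfolding B_def by blast
    then show ?thesis by simp
  qed
  have nested_P: "nested b t" if t: "t \<in> P \<inter> T" for t
  proof (cases "\<exists>r\<in>I. t \<le> r")
    case True
    then obtain r where "r \<in> I" "t \<le> r"
      by blast
    then have "b \<le> t\<^sup>\<star>"
      using b_le[of r] by (meson order.trans star_le_iff)
    then show ?thesis
      by (simp add: nested_iff)
  next
    case False
    then have "t \<le> s"
      using t unfolding I_def by blast
    moreover have "t \<le> r\<^sup>\<star>" if r: "r \<in> I" for r
    proof -
      have "r \<in> P \<inter> T" "\<not> r \<le> t" "\<not> t \<le> r"
        using r False \<open>t \<le> s\<close> unfolding I_def by auto
      moreover from this have "\<not> r\<^sup>\<star> \<le> t"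
        using profile_down_closed[of P t "r\<^sup>\<star>"] t PQ TS star_mem_profile_iff[of P r] by auto
      ultimately show ?thesis
        using T(2)[of t r] t unfolding nested_iff by blast
    qed
    ultimately have "t \<le> b"
      by (intro b(3)) (auto simp: B_def)
    then show ?thesis
      by (simp add: nested_iff)
  qed
  have "nested b t" if t: "t \<in> T" for t
  proof (cases "t \<in> P")
    case True
    then show ?thesis
      using t nested_P by blast
  next
    case False
    then have "t\<^sup>\<star> \<in> P \<inter> T"
      using t T TS PQ star_mem_profile_iff by blast
    then show ?thesis
      using nested_P nested_star nested_sym by metis
  qed
  with b show thesis
    using that by blast
qed

lemma maximal_nested_exists:
  obtains T where "T \<subseteq> relevant" "\<And>s t. s \<in> T \<Longrightarrow> t \<in> T \<Longrightarrow> nested s t"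
    "\<And>s. s \<in> relevant \<Longrightarrow> (\<And>t. t \<in> T \<Longrightarrow> nested s t) \<Longrightarrow> s \<in> T"
proof -
  define A where "A = {T. T \<subseteq> relevant \<and> (\<forall>s\<in>T. \<forall>t\<in>T. nested s t)}"
  obtain T where T: "maximal_element A T"
  proof (rule Zorn_order)
    show "A \<noteq> {}"
      unfolding A_def by blast
  next
    fix C assume C: "C \<subseteq> A" "C \<noteq> {}" "Complete_Partial_Order.chain (\<subseteq>) C"
    have "nested s t" if "s \<in> X" "X \<in> C" "t \<in> Y" "Y \<in> C" for s t X Y
    proof -
      have "X \<subseteq> Y \<or> Y \<subseteq> X"
        using C that by (simp add: chain_def)
      then show ?thesis
        using C that unfolding A_def by blast
    qed
    then have "\<Union>C \<in> A"
      using C unfolding A_def by blast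
    then show "\<exists>U\<in>A. \<forall>X\<in>C. X \<subseteq> U"
      by blast
  qed
  show thesis
  proof (rule that)
    show "T \<subseteq> relevant" "\<And>s t. s \<in> T \<Longrightarrow> t \<in> T \<Longrightarrow> nested s t"
      using T unfolding maximal_element_def A_def by blast+
    fix s assume s: "s \<in> relevant" "\<And>t. t \<in> T \<Longrightarrow> nested s t"
    then have "nested t s" if "t \<in> T" for t
      using that by (subst nested_sym)
    with s have "insert s T \<in> A"
      using T unfolding maximal_element_def A_def by (simp add: nested_refl)
    then have "\<not> T \<subset> insert s T"
      using T unfolding maximal_element_def by blast
    then show "s \<in> T"
      by blast
  qed
qed

end

theorem theorem3p6:
  fixes S :: "'u::sep_universe set" and \<P> :: "'u set set"
  assumes "separation_system S" and "regular S"
    and "\<forall>P\<in>\<P>. closed_profile S P"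
    and "orderly S \<P>"
  shows "\<exists>T\<subseteq>S. tree_set T \<and>
    (\<forall>P\<in>\<P>. \<forall>Q\<in>\<P>. P \<noteq> Q \<longrightarrow> (\<exists>t\<in>T. distinguishes t P Q)) \<and>
    (\<forall>t\<in>T. \<exists>P\<in>\<P>. \<exists>Q\<in>\<P>. P \<noteq> Q \<and> distinguishes t P Q) \<and>
    (\<forall>P\<in>\<P>. \<forall>s\<in>P \<inter> T. \<exists>m. maximal_element (P \<inter> T) m \<and> s \<le> m)"
proof -
  interpret orderly_closed_profiles S \<P>
    using assms by unfold_locales auto
  obtain T where T: "T \<subseteq> relevant" "\<And>s t. s \<in> T \<Longrightarrow> t \<in> T \<Longrightarrow> nested s t"
    "\<And>s. s \<in> relevant \<Longrightarrow> (\<And>t. t \<in> T \<Longrightarrow> nested s t) \<Longrightarrow> s \<in> T"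
    using maximal_nested_exists by blast
  have TS: "T \<subseteq> S"
    using T(1) relevant_subset by blast
  have T_star: "t\<^sup>\<star> \<in> T" if "t \<in> T" for t
    using that T relevant_star nested_star by blast
  have "\<not> trivial_in T s" if s: "s \<in> T" for s
  proof
    assume "trivial_in T s"
    then obtain r where "s \<le> r" "s \<le> r\<^sup>\<star>"
      unfolding trivial_in_def by (meson less_imp_le)
    then have "s \<le> s\<^sup>\<star>"
      by (meson le_star_iff order.trans)
    then show False
      using not_le_star s TS by blast
  qed
  then have "tree_set T"
    using T(2) T_star TS star_neq
    unfolding tree_set_def separation_system_def degenerate_def by blast
  moreover have "\<exists>t\<in>T. distinguishes t P Q" if PQ: "P \<in> \<P>" "Q \<in> \<P>" "P \<noteq> Q" for P Q
  proof (rule ccontr)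
    assume "\<not> ?thesis"
    then have disjoint: "T \<inter> separators P Q = {}"
      using distinguishes_iff PQ by blast
    obtain b where b: "b \<in> separators P Q" "\<And>t. t \<in> T \<Longrightarrow> nested b t"
      using nested_separator_exists[OF PQ T(1,2) T_star disjoint] by blast
    then have "b \<in> T"
      using T(3) relevantI PQ by blast
    with b disjoint show False
      by blast
  qed
  moreover have "\<exists>P\<in>\<P>. \<exists>Q\<in>\<P>. P \<noteq> Q \<and> distinguishes t P Q" if t: "t \<in> T" for t
  proof -
    obtain P Q where PQ: "P \<in> \<P>" "Q \<in> \<P>" "t \<in> separators P Q"
      using T(1) t unfolding relevant_def by blast
    then have "P \<noteq> Q"
      using star_mem_profile_iff profile_subset unfolding separators_def by blast
    with PQ show ?thesis
      using distinguishes_iff by blast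
  qed
  moreover have "\<exists>m. maximal_element (P \<inter> T) m \<and> s \<le> m"
    if P: "P \<in> \<P>" and s: "s \<in> P \<inter> T" for P s
  proof -
    define A where "A = {x \<in> P \<inter> T. s \<le> x}"
    obtain m where m: "maximal_element A m"
    proof (rule Zorn_order)
      show "A \<noteq> {}"
        using s unfolding A_def by blast
    next
      fix C assume C: "C \<subseteq> A" "C \<noteq> {}" "Complete_Partial_Order.chain (\<le>) C"
      then have "C \<subseteq> P" "C \<subseteq> T"
        unfolding A_def by auto
      obtain u where u: "isLub UNIV C u" "u \<in> P"
        using profile_chain_Lub[OF P \<open>C \<subseteq> P\<close>] C by blast
      have upper: "c \<le> u" if "c \<in> C" for c
        using u that by (meson isLubD2)
      \<comment> \<open>Any profile that \<open>P\<close> is separated from by one element of the chain is also separated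
        from \<open>P\<close> by the supremum, so \<open>u\<close> is relevant.\<close>
      obtain c where c: "c \<in> C"
        using C by blast
      then obtain R where "R \<in> \<P>" "c \<in> separators P R"
        using relevant_in_separators[OF P, of c] \<open>C \<subseteq> P\<close> \<open>C \<subseteq> T\<close> T(1) by blast
      then have "u \<in> relevant"
        using separators_up_closed[OF P _ _ u(2) upper[OF c]] relevantI P by blast
      moreover have "nested u t" if "t \<in> T" for t
        using nested_chain_Lub[OF C(3) u(1)] \<open>C \<subseteq> T\<close> T(2) that by blast
      ultimately have "u \<in> T"
        using T(3) by blast
      moreover have "s \<le> u"
        using c C(1) upper[OF c] unfolding A_def by (auto intro: order.trans)
      ultimately show "\<exists>u\<in>A. \<forall>c\<in>C. c \<le> u"
        using u upper unfolding A_def by blast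
    qed
    have "\<not> m < x" if "x \<in> P \<inter> T" for x
    proof
      assume "m < x"
      then have "x \<in> A"
        using m that unfolding maximal_element_def A_def by auto
      with \<open>m < x\<close> m show False
        unfolding maximal_element_def by blast
    qed
    with m show ?thesis
      unfolding maximal_element_def A_def by blast
  qed
  ultimately show ?thesis
    using TS by (intro exI[of _ T]) simp
qed

end
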